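(* Let $\mathcal{A}$ be a unital Banach algebra and let $a\in\mathcal{A}$ be co-EP. If $b\in\mathcal{A}$ obeys the condition $(\mathcal{P})$ at $a$, then $b$ is co-EP, $bb^{\dagger}=aa^{\dagger}$ and $b^{\dagger}b=a^{\dagger}a$.
   Context: $\mathcal{A}$ denotes a complex unital Banach algebra with unit $1$. An element $c\in\mathcal{A}$ is hermitian if $\|\exp(itc)\|=1$ for all $t\in\mathbb{R}$. An element $a\in\mathcal{A}$ is Moore-Penrose invertible if there exists $x\in\mathcal{A}$ with $axa=a$, $xax=x$ and both $ax$ and $xa$ hermitian; such $x$ is unique, is called the Moore-Penrose inverse of $a$ and is denoted $a^{\dagger}$. An element $a$ is co-EP if it is Moore-Penrose invertible and $aa^{\dagger}-a^{\dagger}a$ is invertible in $\mathcal{A}$. For $a$ Moore-Penrose invertible, an element $b\in\mathcal{A}$ obeys the condition $(\mathcal{P})$ at $a$ if $b-a=aa^{\dagger}(b-a)a^{\dagger}a$ and $\|a^{\dagger}(b-a)\|<1$. *)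

theory Defs
  imports Complex_Main
begin

text \<open>
  Complex unital Banach algebras. The library only has the real version, so the complex
  scalar multiplication is added on top of it, compatibly with the existing real one.
  The inherited axiom \<open>norm 1 = 1\<close> is no restriction below: if it fails, then
  \<open>exp 0 = 1\<close> does not have norm 1, and the algebra has no hermitian elements at all.
\<close>

class complex_banach_algebra_1 = real_normed_algebra_1 + banach +
  fixes scaleC :: "complex \<Rightarrow> 'a \<Rightarrow> 'a"  (infixr "*\<^sub>C" 75)
  assumes scaleC_add_right: "c *\<^sub>C (x + y) = c *\<^sub>C x + c *\<^sub>C y"
    and scaleC_add_left: "(c + d) *\<^sub>C x = c *\<^sub>C x + d *\<^sub>C x"
    and scaleC_scaleC: "c *\<^sub>C (d *\<^sub>C x) = (c * d) *\<^sub>C x"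
    and scaleC_of_real: "complex_of_real r *\<^sub>C x = scaleR r x"
    and mult_scaleC_left: "(c *\<^sub>C x) * y = c *\<^sub>C (x * y)"
    and mult_scaleC_right: "x * (c *\<^sub>C y) = c *\<^sub>C (x * y)"
    and norm_scaleC: "norm (c *\<^sub>C x) = cmod c * norm x"

definition hermitian :: "'a::complex_banach_algebra_1 \<Rightarrow> bool" where
  "hermitian c \<longleftrightarrow> (\<forall>t::real. norm (exp ((\<i> * complex_of_real t) *\<^sub>C c)) = 1)"

definition is_mp_inverse :: "'a::complex_banach_algebra_1 \<Rightarrow> 'a \<Rightarrow> bool" where
  "is_mp_inverse a x \<longleftrightarrow>
     a * x * a = a \<and> x * a * x = x \<and> hermitian (a * x) \<and> hermitian (x * a)"

definition mp_invertible :: "'a::complex_banach_algebra_1 \<Rightarrow> bool" where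
  "mp_invertible a \<longleftrightarrow> (\<exists>x. is_mp_inverse a x)"

text \<open>Meaningful only if \<open>mp_invertible a\<close>; the Moore-Penrose inverse is then unique.\<close>

definition mp_inverse :: "'a::complex_banach_algebra_1 \<Rightarrow> 'a" where
  "mp_inverse a = (THE x. is_mp_inverse a x)"

text \<open>
  Two-sided invertibility. The library's \<open>is_unit\<close> (\<open>u dvd 1\<close>) would only
  give a right inverse in a noncommutative ring.
\<close>

definition alg_invertible :: "'a::monoid_mult \<Rightarrow> bool" where
  "alg_invertible u \<longleftrightarrow> (\<exists>v. u * v = 1 \<and> v * u = 1)"

definition co_EP :: "'a::complex_banach_algebra_1 \<Rightarrow> bool" where
  "co_EP a \<longleftrightarrow>
     mp_invertible a \<and> alg_invertible (a * mp_inverse a - mp_inverse a * a)"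

definition obeys_P_at :: "'a::complex_banach_algebra_1 \<Rightarrow> 'a \<Rightarrow> bool" where
  "obeys_P_at b a \<longleftrightarrow>
     mp_invertible a \<and>
     b - a = a * mp_inverse a * (b - a) * mp_inverse a * a \<and>
     norm (mp_inverse a * (b - a)) < 1"

end

theory Submission
  imports Defs
begin

text \<open>
  For an idempotent \<open>p\<close> one has \<open>exp (i\<pi>p) = 1 - 2p\<close>, so \<open>1 - 2p\<close> has norm 1 if \<open>p\<close> is also
  hermitian. If two hermitian idempotents \<open>p\<close>, \<open>q\<close> have the same range or the same kernel, then
  \<open>n = p - q\<close> satisfies \<open>n\<^sup>2 = 0\<close> and \<open>1 + 2n\<close> or \<open>1 - 2n\<close> is the product \<open>(1 - 2p)(1 - 2q)\<close>
  of norm at most 1; its powers \<open>1 \<plusminus> 2kn\<close> are bounded, hence \<open>n = 0\<close>. This gives uniqueness of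
  the Moore-Penrose inverse.
  Condition (P) makes \<open>b = a(1 + w)\<close> with \<open>w = a\<^sup>\<dagger>(b - a)\<close>, where \<open>1 + w\<close> is invertible by the
  Neumann series and commutes with \<open>a\<^sup>\<dagger>a\<close>. Then \<open>(1 + w)\<^sup>-\<^sup>1a\<^sup>\<dagger>\<close> is a Moore-Penrose inverse
  of \<open>b\<close> with the same two projections.
\<close>

lemma bounded_linear_scaleC_left:
  "bounded_linear (\<lambda>c. c *\<^sub>C (p::'a::complex_banach_algebra_1))"
proof (rule bounded_linear_intro)
  show "(r *\<^sub>R c) *\<^sub>C p = r *\<^sub>R (c *\<^sub>C p)" for r c
    by (metis scaleC_of_real scaleC_scaleC scaleR_conv_of_real)
qed (auto simp: scaleC_add_left norm_scaleC)

lemma exp_scaleC_idempotent: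
  fixes p :: "'a::complex_banach_algebra_1"
  assumes p: "p * p = p"
  shows "exp (c *\<^sub>C p) = 1 + (exp c - 1) *\<^sub>C p"
proof -
  interpret L: bounded_linear "\<lambda>c. c *\<^sub>C p" by (rule bounded_linear_scaleC_left)
  have pow: "(c *\<^sub>C p) ^ Suc n = (c ^ Suc n) *\<^sub>C p" for n
  proof (induction n)
    case (Suc n)
    then show ?case
      by (simp add: mult_scaleC_left mult_scaleC_right p scaleC_scaleC
          power_Suc[of _ "Suc n"] mult.commute[of c] del: power_Suc)
  qed simp
  have "(\<lambda>n. c ^ n /\<^sub>R fact n) sums exp c"
    by (rule exp_converges)
  \<comment> \<open>The constant term is split off because \<open>c ^ n *\<^sub>C p\<close> is the
    power of \<open>c *\<^sub>C p\<close> only for positive \<open>n\<close>; at 0 the power is 1,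
    not \<open>p\<close>.\<close>
  then have "(\<lambda>n. c ^ Suc n /\<^sub>R fact (Suc n)) sums (exp c - 1)"
    by (subst sums_Suc_iff) simp
  from L.sums[OF this]
  have "(\<lambda>n. (c *\<^sub>C p) ^ Suc n /\<^sub>R fact (Suc n)) sums ((exp c - 1) *\<^sub>C p)"
    by (simp only: L.scaleR pow)
  then have "(\<lambda>n. (c *\<^sub>C p) ^ n /\<^sub>R fact n) sums ((exp c - 1) *\<^sub>C p + 1)"
    by (subst (asm) sums_Suc_iff) simp
  then show ?thesis
    by (metis exp_converges sums_unique2 add.commute)
qed

lemma norm_one_minus_double_hermitian_idempotent:
  fixes p :: "'a::complex_banach_algebra_1"
  assumes "p * p = p" and "hermitian p"
  shows "norm (1 - 2 *\<^sub>R p) = 1"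
proof -
  have "(-2::complex) *\<^sub>C p = - 2 *\<^sub>R p"
    using scaleC_of_real[of "-2" p] by simp
  then have "exp ((\<i> * complex_of_real pi) *\<^sub>C p) = 1 - 2 *\<^sub>R p"
    using exp_scaleC_idempotent[OF assms(1), of "\<i> * complex_of_real pi"]
    by (simp add: mult.commute[of \<i>])
  then show ?thesis
    using assms(2) unfolding hermitian_def by metis
qed

lemma square_zero_eq_0_if_norm_one_plus_le_1:
  fixes n :: "'a::real_normed_algebra_1"
  assumes "n * n = 0" and "norm (1 + n) \<le> 1"
  shows "n = 0"
proof (rule ccontr)
  assume "n \<noteq> 0"
  \<comment> \<open>The bound 2 is what the triangle inequality yields for
    \<open>real k *\<^sub>R n\<close>, as both \<open>1 + real k *\<^sub>R n\<close> and 1 have norm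
    at most 1.\<close>
  then obtain k :: nat where k: "2 < real k * norm n"
    by (metis reals_Archimedean3 zero_less_norm_iff)
  have "(1 + n) ^ k = 1 + real k *\<^sub>R n"
    by (induction k) (simp_all add: algebra_simps assms(1))
  then have "norm (1 + real k *\<^sub>R n) \<le> 1"
    by (metis assms(2) norm_ge_zero norm_power_ineq order_trans power_le_one)
  then have "norm (real k *\<^sub>R n) \<le> 2"
    using norm_triangle_ineq4[of "1 + real k *\<^sub>R n" 1] by simp
  then show False
    using k by simp
qed

text \<open>For left multiplications, the first alternative means equal ranges and the second equal
  kernels.\<close>

lemma hermitian_idempotents_eq:
  fixes p q :: "'a::complex_banach_algebra_1"
  assumes "p * p = p" "q * q = q" "hermitian p" "hermitian q"
    and "p * q = q \<and> q * p = p \<or> p * q = p \<and> q * p = q"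
  shows "p = q"
proof -
  have le: "norm ((1 - 2 *\<^sub>R p) * (1 - 2 *\<^sub>R q)) \<le> 1"
    using norm_mult_ineq[of "1 - 2 *\<^sub>R p" "1 - 2 *\<^sub>R q"] assms(1-4)
    by (simp add: norm_one_minus_double_hermitian_idempotent)
  have prod: "(1 - 2 *\<^sub>R p) * (1 - 2 *\<^sub>R q) = 1 - 2 *\<^sub>R p - 2 *\<^sub>R q + 4 *\<^sub>R (p * q)"
    by (simp add: algebra_simps)
  from assms(5) consider "p * q = q" "q * p = p" | "p * q = p" "q * p = q"
    by blast
  then show ?thesis
  proof cases
    case 1
    have "(1 - 2 *\<^sub>R p) * (1 - 2 *\<^sub>R q) = 1 + 2 *\<^sub>R (q - p)"
      unfolding prod 1 using scaleR_add_left[of 2 2 q] by (simp add: algebra_simps)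
    moreover have "(2 *\<^sub>R (q - p)) * (2 *\<^sub>R (q - p)) = 0"
      using assms(1,2) 1 by (simp add: algebra_simps)
    ultimately have "2 *\<^sub>R (q - p) = 0"
      using le square_zero_eq_0_if_norm_one_plus_le_1 by metis
    then show ?thesis by simp
  next
    case 2
    have "(1 - 2 *\<^sub>R p) * (1 - 2 *\<^sub>R q) = 1 + 2 *\<^sub>R (p - q)"
      unfolding prod 2 using scaleR_add_left[of 2 2 p] by (simp add: algebra_simps)
    moreover have "(2 *\<^sub>R (p - q)) * (2 *\<^sub>R (p - q)) = 0"
      using assms(1,2) 2 by (simp add: algebra_simps)
    ultimately have "2 *\<^sub>R (p - q) = 0"
      using le square_zero_eq_0_if_norm_one_plus_le_1 by metis
    then show ?thesis by simp
  qed
qed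

lemma is_mp_inverse_unique:
  assumes "is_mp_inverse a x" and "is_mp_inverse a y"
  shows "x = y"
proof -
  have x: "a * x * a = a" "x * a * x = x" "hermitian (a * x)" "hermitian (x * a)"
    and y: "a * y * a = a" "y * a * y = y" "hermitian (a * y)" "hermitian (y * a)"
    using assms by (simp_all add: is_mp_inverse_def)
  have left: "(a * u) * (a * v) = a * v" if "a * u * a = a" for u v
    using that by (simp flip: mult.assoc)
  have right: "(u * a) * (v * a) = u * a" if "a * v * a = a" for u v
    using that by (simp add: mult.assoc)
  have "a * x = a * y"
    by (rule hermitian_idempotents_eq) (simp_all only: left x y simp_thms)
  moreover have "x * a = y * a"
    by (rule hermitian_idempotents_eq) (simp_all only: right x y simp_thms)
  \<comment> \<open>Here \<open>x = (x * a) * x = (y * a) * x = y * (a * x) = y * (a * y) =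
    y\<close>.\<close>
  ultimately show ?thesis
    using x(2) y(2) by (metis mult.assoc)
qed

lemma mp_inverse_eq: "is_mp_inverse a x \<Longrightarrow> mp_inverse a = x"
  unfolding mp_inverse_def using is_mp_inverse_unique by blast

lemma alg_invertible_one_plus:
  fixes w :: "'a::{real_normed_algebra_1,banach}"
  assumes "norm w < 1"
  shows "alg_invertible (1 + w)"
proof -
  let ?s = "\<Sum>n. (- w) ^ n"
  have sm: "summable (\<lambda>n. (- w) ^ n)"
    using assms by (simp add: complete_algebra_summable_geometric)
  have "?s = 1 + (\<Sum>n. (- w) ^ Suc n)"
    using suminf_split_head[OF sm] by simp
  moreover have "(\<Sum>n. (- w) ^ Suc n) = - w * ?s"
    using suminf_mult[OF sm, of "- w"] by simp
  moreover have "(\<Sum>n. (- w) ^ Suc n) = ?s * - w"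
    using suminf_mult2[OF sm, of "- w"] by (simp only: power_Suc2)
  ultimately have "(1 + w) * ?s = 1" "?s * (1 + w) = 1"
    by (simp_all add: algebra_simps)
  then show ?thesis
    unfolding alg_invertible_def by blast
qed

lemma obeys_P_at_mp_inverse:
  assumes "is_mp_inverse a x" and "obeys_P_at b a"
  obtains y where "is_mp_inverse b y" "b * y = a * x" "y * b = x * a"
proof -
  have x: "a * x * a = a" "x * a * x = x" "hermitian (a * x)" "hermitian (x * a)"
    using assms(1) by (auto simp: is_mp_inverse_def)
  define w where "w = x * (b - a)"
  have P: "b - a = a * x * (b - a) * x * a" "norm w < 1"
    using assms unfolding obeys_P_at_def mp_inverse_eq[OF assms(1)] w_def by blast+
  obtain v where v: "(1 + w) * v = 1" "v * (1 + w) = 1"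
    using alg_invertible_one_plus[OF P(2)] by (auto simp: alg_invertible_def)
  \<comment> \<open>By (P), \<open>b - a\<close> has the idempotent \<open>a * x\<close> as a left
    factor and \<open>x * a\<close> as a right factor, so each absorbs into it.\<close>
  have "(b - a) * (x * a) = b - a"
    using P(1) x(1) by (metis mult.assoc)
  then have wp: "w * (x * a) = w"
    by (simp add: w_def mult.assoc)
  have pw: "(x * a) * w = w"
    using x(2) by (metis w_def mult.assoc)
  have "a * w = b - a"
    using P(1) x(1) by (metis w_def mult.assoc)
  then have b: "b = a * (1 + w)"
    by (simp add: algebra_simps)
  have comm: "(x * a) * (1 + w) = (1 + w) * (x * a)"
    using wp pw by (simp add: distrib_left distrib_right)
  let ?y = "v * x"
  have b_y: "b * ?y = a * x"
    using v(1) by (metis b mult.assoc mult_1_left)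
  \<comment> \<open>Commutation moves \<open>1 + w\<close> next to its inverse:
    \<open>v * (x * a) * (1 + w) = v * (1 + w) * (x * a)\<close>.\<close>
  have yb: "?y * b = x * a"
    using v(2) comm by (metis b mult.assoc mult_1_left)
  \<comment> \<open>An inverse commutes with whatever the element commutes with.\<close>
  have "(x * a) * v = v * (x * a)"
    using v comm by (metis mult.assoc mult_1_left mult_1_right)
  then have "?y * b * ?y = ?y"
    using yb x(2) by (metis mult.assoc)
  moreover have "b * ?y * b = b"
    using b_y x(1) by (metis b mult.assoc)
  ultimately have "is_mp_inverse b ?y"
    using x b_y yb by (simp add: is_mp_inverse_def)
  then show thesis
    using b_y yb that by blast
qed

theorem corollary4p3:
  fixes a b :: "'a::complex_banach_algebra_1"
  assumes "co_EP a"
    and "obeys_P_at b a"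
  shows "co_EP b \<and>
         b * mp_inverse b = a * mp_inverse a \<and>
         mp_inverse b * b = mp_inverse a * a"
proof -
  obtain x where x: "is_mp_inverse a x"
    using assms(1) by (auto simp: co_EP_def mp_invertible_def)
  obtain y where y: "is_mp_inverse b y" "b * y = a * x" "y * b = x * a"
    using obeys_P_at_mp_inverse[OF x assms(2)] .
  \<comment> \<open>Invertibility transfers because the difference of the two projections is the
    same for \<open>b\<close> as for \<open>a\<close>.\<close>
  then show ?thesis
    using assms(1) x by (auto simp: co_EP_def mp_invertible_def mp_inverse_eq)
qed

end
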